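(* Suppose a deck of $n$ cards is given one single-shelf shuffle, and let $E(n)$ be the expected number of correct guesses when the player uses, with no feedback, the guessing strategy described in the context. Then there is a sequence of real numbers $(C_n)$ with $$\limsup_{n\to\infty}\frac{C_n}{e^{-2}(2\pi)^{-1/2}(n-\sqrt n)^{1/2}}\leq 1$$ such that, as $n\to\infty$, $$E(n)\sim\sqrt{\frac{2}{\pi}}\,\sqrt{n-\sqrt n}+2\Phi(1)-1+C_n,$$ i.e. the ratio of the two sides tends to $1$. Here $\Phi$ is the cumulative distribution function of an $\mathcal N(0,1)$ random variable.
   Context: Single-shelf shuffle: a deck of cards is initially labeled $1,2,\dots,n$ from top to bottom. Cards are drawn one at a time from the bottom (card $n$ first) and placed in a pile; each drawn card is placed, independently, on the top or at the bottom of the existing pile with probability $1/2$ each. The final pile is the shuffled deck; position $1$ is its top. The probability that card $i$ lands in position $j$ is $p_{i,j}=\frac{\binom{i-1}{j-1}+\binom{i-1}{n-j}}{2^i}$, where $\binom ab=0$ for $b>a\ge 0$. If card $g_j$ is guessed in position $j$ for $1\le j\le n$, the expected number of correct guesses is $\sum_{j=1}^n p_{g_j,j}$. The strategy (for $n\geq 6$): let $\alpha_n=n/3$ if $n\equiv 0$, $\alpha_n=\lfloor n/3\rfloor$ if $n\equiv 1$, $\alpha_n=\lceil n/3\rceil$ if $n\equiv 2\pmod 3$. If $n$ is odd, put $h=\frac{n+1}{2}$ and let $m$ be the largest nonnegative integer with $(2m)^2+1\leq n$; call $n$ exceptional if $n=(2m)^2+1$. If $n$ is even, put $h=\frac n2$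 and let $m$ be the largest nonnegative integer with $(2m+1)^2+1\leq n$; call $n$ exceptional if $n=(2m+1)^2+1$. The guess $g_j$ in position $j\le h$ is any card of the set $A_j$, where: - $A_1=\{1\}$, and $A_j=\{2j-2,2j-1\}$ for $2\leq j\leq\alpha_n$; - $A_j=\{2j-1\}$ for $\alpha_n+1\leq j\leq h-m-1$; - $A_{h-m}=\{n-3,n-2,n-1,n\}$ if $n$ is exceptional, and $A_{h-m}=\{n-1,n\}$ otherwise; - $A_j=\{n-1,n\}$ for $h-m+1\leq j\leq h$. For positions in the second half of the deck, $A_{n-j+1}=A_j$, and $g_{n-j+1}$ is any card of that set. The claim holds for any such choice of guesses. *)

theory Defs
  imports "HOL-Probability.Probability" "HOL-Library.Landau_Symbols"
begin

(* Decks and piles are lists with the top card first.  The recursion draws from the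
   bottom: the cards below c have already been piled up when c is drawn. *)
primrec shelf_shuffle :: "'a list \<Rightarrow> 'a list pmf" where
  "shelf_shuffle [] = return_pmf []"
| "shelf_shuffle (c # cs) =
     bind_pmf (shelf_shuffle cs) (\<lambda>pile.
       map_pmf (\<lambda>on_top. if on_top then c # pile else pile @ [c]) (bernoulli_pmf (1 / 2)))"

(* Positions are 1-based and list indices are 0-based. *)
definition correct_guesses :: "nat \<Rightarrow> (nat \<Rightarrow> nat) \<Rightarrow> nat list \<Rightarrow> nat" where
  "correct_guesses n g pile = card {j \<in> {1..n}. pile ! (j - 1) = g j}"

definition expected_correct :: "nat \<Rightarrow> (nat \<Rightarrow> nat) \<Rightarrow> real" where
  "expected_correct n g =
     measure_pmf.expectation (shelf_shuffle [1..<Suc n]) (\<lambda>pile. real (correct_guesses n g pile))"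

definition strat_alpha :: "nat \<Rightarrow> nat" where
  "strat_alpha n = (if n mod 3 = 2 then nat \<lceil>real n / 3\<rceil> else nat \<lfloor>real n / 3\<rfloor>)"

definition strat_half :: "nat \<Rightarrow> nat" where
  "strat_half n = (if odd n then (n + 1) div 2 else n div 2)"

definition strat_m :: "nat \<Rightarrow> nat" where
  "strat_m n = (if odd n then (GREATEST m. (2 * m)\<^sup>2 + 1 \<le> n)
                else (GREATEST m. (2 * m + 1)\<^sup>2 + 1 \<le> n))"

definition exceptional :: "nat \<Rightarrow> bool" where
  "exceptional n \<longleftrightarrow> (if odd n then n = (2 * strat_m n)\<^sup>2 + 1 else n = (2 * strat_m n + 1)\<^sup>2 + 1)"

(* Only meant for n \<ge> 6 and 1 \<le> j \<le> strat_half n.  There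
   strat_alpha n \<le> strat_half n - strat_m n - 1, so the case ranges do not overlap
   and no subtraction truncates. *)
definition half_guess_set :: "nat \<Rightarrow> nat \<Rightarrow> nat set" where
  "half_guess_set n j =
     (if j = 1 then {1}
      else if j \<le> strat_alpha n then {2 * j - 2, 2 * j - 1}
      else if j \<le> strat_half n - strat_m n - 1 then {2 * j - 1}
      else if j = strat_half n - strat_m n then
        (if exceptional n then {n - 3, n - 2, n - 1, n} else {n - 1, n})
      else {n - 1, n})"

definition guess_set :: "nat \<Rightarrow> nat \<Rightarrow> nat set" where
  "guess_set n j =
     (if j \<le> strat_half n then half_guess_set n j else half_guess_set n (n + 1 - j))"

definition follows_strategy :: "nat \<Rightarrow> (nat \<Rightarrow> nat) \<Rightarrow> bool" where
  "follows_strategy n g \<longleftrightarrow> (\<forall>j\<in>{1..n}. g j \<in> guess_set n j)"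

definition std_normal_cdf :: "real \<Rightarrow> real" where
  "std_normal_cdf = cdf (density lborel std_normal_density)"

end

(* Taking C n to be the difference of E n and the main term, only the upper bound
   E n <= sqrt (2 n / pi) + O(1) is needed.  Let c k = (2k choose k) / 4^k.  For the guesses
   2j-2 and 2j-1 in position j, p_{i,j} is at most c (j-1) / 2 plus the probability that a
   renewal process takes the value n-1 at step j-1.  The sum of c k over k < h is 2 h c h,
   which is at most 2 sqrt (h / pi) by Wallis' product, and the renewal terms sum up to at most
   1.  Near the middle of the deck O(sqrt n) positions are guessed with one of the last four
   cards, and each of them is correct with probability O(1 / sqrt n). *)
theory Submission
  imports Defs "HOL-Real_Asymp.Real_Asymp"
begin

subsection \<open>Central binomial probabilities\<close>

definition central_prob :: "nat \<Rightarrow> real" where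
  "central_prob k = real ((2 * k) choose k) / 4 ^ k"

lemma central_prob_pos: "central_prob k > 0"
  by (simp add: central_prob_def)

lemma central_prob_0: "central_prob 0 = 1"
  by (simp add: central_prob_def)

lemma central_prob_Suc:
  "central_prob (Suc h) = (2 * real h + 1) / (2 * real h + 2) * central_prob h"
proof -
  have c: "central_prob k = fact (2 * k) / ((fact k)\<^sup>2 * 4 ^ k)" for k
    by (simp add: central_prob_def binomial_fact power2_eq_square)
  have "fact (2 * Suc h) = (2 * real h + 2) * (2 * real h + 1) * fact (2 * h)"
    by (simp add: algebra_simps)
  moreover have "(fact (Suc h))\<^sup>2 * 4 ^ Suc h = (2 * real h + 2)\<^sup>2 * ((fact h)\<^sup>2 * 4 ^ h)"
    by (simp add: power2_eq_square algebra_simps)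
  ultimately show ?thesis unfolding c
    by (simp only: power2_eq_square times_divide_times_eq) (simp add: divide_simps del: of_nat_Suc)
qed

text \<open>The sum telescopes: by \<open>central_prob_Suc\<close>, the right-hand side grows by
  exactly \<open>central_prob h\<close> from \<open>h\<close> to \<open>Suc h\<close>.\<close>

lemma sum_central_prob: "(\<Sum>k<h. central_prob k) = 2 * real h * central_prob h"
  by (induction h) (simp_all add: central_prob_Suc field_simps)

text \<open>The new Wallis factor (2n+2)^2 / ((2n+1)(2n+3)) cancels the squared ratio from
  \<open>central_prob_Suc\<close> together with the change from 2n+1 to 2n+3.\<close>

lemma wallis_prod_central_prob:
  "(\<Prod>k=1..n. (4*real k^2) / (4*real k^2 - 1)) * ((2 * real n + 1) * (central_prob n)\<^sup>2) = 1"
proof (induction n)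
  case (Suc n)
  let ?P = "\<Prod>k=1..n. (4*real k^2) / (4*real k^2 - 1)"
  let ?f = "(4 * real (Suc n)^2) / (4 * real (Suc n)^2 - 1)"
  have f: "?f * ((2 * real (Suc n) + 1) * ((2 * real n + 1) / (2 * real n + 2))\<^sup>2) = 2 * real n + 1"
  proof -
    have "4 * real (Suc n)^2 - 1 = (2 * real n + 1) * (2 * real n + 3)"
      and "4 * real (Suc n)^2 = (2 * real n + 2)\<^sup>2" and "2 * real (Suc n) + 1 = 2 * real n + 3"
      by (simp_all add: algebra_simps power2_eq_square)
    note eqs = this
    have "2 * real n + 1 \<noteq> 0" "2 * real n + 2 \<noteq> 0" "2 * real n + 3 \<noteq> 0" by linarith+
    thus ?thesis unfolding eqs(1) unfolding eqs(2,3) power_divide by (simp add: power2_eq_square del: distrib_left_numeral)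
  qed
  have "(\<Prod>k=1..Suc n. (4*real k^2) / (4*real k^2 - 1)) * ((2 * real (Suc n) + 1) * (central_prob (Suc n))\<^sup>2)
      = (?P * ?f) * ((2 * real (Suc n) + 1) * (((2 * real n + 1) / (2 * real n + 2))\<^sup>2 * (central_prob n)\<^sup>2))"
    by (simp add: central_prob_Suc power_divide power_mult_distrib del: of_nat_Suc)
  also have "\<dots> = ?P * (?f * ((2 * real (Suc n) + 1) * ((2 * real n + 1) / (2 * real n + 2))\<^sup>2) * (central_prob n)\<^sup>2)"
    by (simp only: mult.assoc)
  finally show ?case unfolding f Suc.IH .
qed (simp add: central_prob_0)

lemma central_prob_le:
  assumes "n > 0"
  shows "central_prob n \<le> 1 / sqrt (pi * real n)"
proof -
  define W where "W n = (\<Prod>k=1..n. (4*real k^2) / (4*real k^2 - 1))" for n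
  note cpos = central_prob_pos
  have W: "W n = 1 / ((2 * real n + 1) * (central_prob n)\<^sup>2)" for n
    using wallis_prod_central_prob[of n] unfolding W_def
    by (intro eq_divide_imp) auto
  \<comment> \<open>The partial products \<open>W\<close> increase to pi/2, which would bound
    \<open>central_prob\<close> from below. Replacing 2n+1 by 2n in the denominator gives a sequence
    that decreases to the same limit and so lies above it. The shift to \<open>Suc n\<close> avoids
    a zero denominator.\<close>
  define V where "V n = 1 / (2 * real (Suc n) * (central_prob (Suc n))\<^sup>2)" for n
  have "V (Suc n) \<le> V n" for n
  proof -
    \<comment> \<open>With x = 2n+3 this is (x - 1)(x + 1) \<le> x^2.\<close>
    have "2 * real (Suc n) \<le> 2 * real (Suc (Suc n)) * ((2 * real (Suc n) + 1) / (2 * real (Suc n) + 2))\<^sup>2"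
      by (simp add: power_divide divide_simps) (simp add: power2_eq_square algebra_simps)
    from mult_right_mono[OF this zero_le_power2[of "central_prob (Suc n)"]]
    have "2 * real (Suc n) * (central_prob (Suc n))\<^sup>2 \<le> 2 * real (Suc (Suc n)) * (central_prob (Suc (Suc n)))\<^sup>2"
      unfolding central_prob_Suc[of "Suc n"] power_mult_distrib by (simp only: mult.assoc)
    thus ?thesis unfolding V_def using cpos[of "Suc n"] cpos[of "Suc (Suc n)"]
      by (intro divide_left_mono mult_pos_pos) auto
  qed
  hence "decseq V" by (rule decseq_SucI)
  moreover have "V \<longlonglongrightarrow> pi / 2"
  proof -
    have "V = (\<lambda>n. W (Suc n) * ((2 * real n + 3) / (2 * real n + 2)))"
    proof
      fix n
      have eqs: "2 * real (Suc n) + 1 = 2 * real n + 3" "2 * real (Suc n) = 2 * real n + 2" by simp_all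
      have "2 * real n + 3 \<noteq> 0" "2 * real n + 2 \<noteq> 0" by linarith+
      thus "V n = W (Suc n) * ((2 * real n + 3) / (2 * real n + 2))"
        unfolding V_def W eqs(1) unfolding eqs(2) by (simp del: distrib_left_numeral)
    qed
    moreover have "(\<lambda>n. W (Suc n)) \<longlonglongrightarrow> pi / 2"
      using wallis unfolding W_def by (rule LIMSEQ_Suc)
    moreover have "(\<lambda>n. (2 * real n + 3) / (2 * real n + 2)) \<longlonglongrightarrow> 1" by real_asymp
    ultimately show ?thesis using tendsto_mult[of "\<lambda>n. W (Suc n)" "pi/2" sequentially "\<lambda>n. (2 * real n + 3) / (2 * real n + 2)" 1]
      by simp
  qed
  ultimately have "pi / 2 \<le> V (n - 1)" by (rule decseq_ge)
  hence "(central_prob n)\<^sup>2 \<le> 1 / (pi * real n)"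
    using assms cpos[of n] by (simp add: V_def field_simps)
  hence "central_prob n \<le> sqrt (1 / (pi * real n))" by (rule real_le_rsqrt)
  thus ?thesis by (simp add: real_sqrt_divide)
qed

lemma sum_central_prob_le: "(\<Sum>k<h. central_prob k) \<le> 2 * sqrt (real h / pi)"
proof (cases "h = 0")
  case False
  have "(\<Sum>k<h. central_prob k) \<le> 2 * real h * (1 / sqrt (pi * real h))"
    unfolding sum_central_prob using central_prob_le[of h] False by (intro mult_left_mono) auto
  also have "\<dots> = 2 * (real h / sqrt (real h)) / sqrt pi"
    by (simp add: real_sqrt_mult)
  also have "\<dots> = 2 * sqrt (real h / pi)"
    by (simp add: real_div_sqrt real_sqrt_divide)
  finally show ?thesis .
qed simp

text \<open>For even \<open>N\<close> the central coefficient is the largest. For odd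
  \<open>N\<close>, Pascal's rule gives two coefficients of row \<open>N - 1\<close>, each at most
  the central one.\<close>

lemma binomial_prob_le_central:
  "real (N choose k) / 2 ^ N \<le> central_prob (N div 2)"
proof (cases "even N")
  case True
  then obtain q where "N = 2 * q" by (elim evenE)
  then show ?thesis
    using binomial_maximum'[of q k] by (simp add: central_prob_def power_mult divide_right_mono)
next
  case False
  then obtain q where N: "N = Suc (2 * q)" by (auto elim: oddE)
  have "N choose k \<le> 2 * ((2 * q) choose q)"
    using binomial_maximum'[of q k] binomial_maximum'[of q "k - 1"] unfolding N by (cases k) auto
  hence "real (N choose k) \<le> 2 * real ((2 * q) choose q)"
    by (metis of_nat_le_iff of_nat_mult of_nat_numeral)
  then show ?thesis by (simp add: N central_prob_def power_mult divide_simps)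
qed

subsection \<open>A renewal bound\<close>

text \<open>The sum is the probability that a renewal process whose increments are one plus a
  binomial variable with parameters 2 and 1/2 visits M.\<close>
lemma sum_renewal_le_1: "(\<Sum>r\<le>M. real ((2 * r) choose (M - r)) / 4 ^ r) \<le> 1"
proof (induction M rule: less_induct)
  case (less M)
  define u where "u M = (\<Sum>r\<le>M. real ((2 * r) choose (M - r)) / 4 ^ r)" for M
  show ?case
  proof (cases "M < 3")
    case True
    then consider "M = 0" | "M = 1" | "M = 2" by linarith
    then show ?thesis by cases (simp_all add: numeral_2_eq_2)
  next
    case False
    then obtain L where M: "M = L + 3" by (metis add.commute le_Suc_ex not_less)
    \<comment> \<open>Pascal's rule applied twice, matching the increments 1, 2, 3 with weights 1/4,
      1/2, 1/4. The guards are needed because truncated subtraction would turn a vanishing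
      coefficient into 1.\<close>
    define t where "t s = real ((2 * s) choose (L + 2 - s)) + 2 * (if s \<le> L + 1 then real ((2 * s) choose (L + 1 - s)) else 0)
         + (if s \<le> L then real ((2 * s) choose (L - s)) else 0)" for s
    have t: "real ((2 * Suc s) choose (M - Suc s)) = t s" if "s \<le> L + 2" for s
    proof -
      have "s = L + 2 \<or> s = L + 1 \<or> L = s + (L - s)" using that by linarith
      then consider "s = L + 2" | "s = L + 1" | k where "L = s + k" by blast
      then show ?thesis
      proof cases
        case 3
        have "2 * Suc s = Suc (Suc (2 * s))" "M - Suc s = Suc (Suc k)" "L + 2 - s = Suc (Suc k)"
          "L + 1 - s = Suc k" "L - s = k"
          using 3 by (simp_all add: M)
        then show ?thesis unfolding t_def using 3 by (simp del: mult_Suc_right)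
      qed (simp_all add: t_def M)
    qed
    have "u M = (\<Sum>r\<le>Suc (L + 2). real ((2 * r) choose (M - r)) / 4 ^ r)"
      by (simp add: u_def M eval_nat_numeral)
    also have "\<dots> = (\<Sum>s\<le>L + 2. real ((2 * Suc s) choose (M - Suc s)) / 4 ^ Suc s)"
      \<comment> \<open>The term for r = 0 vanishes since M > 0.\<close>
      by (subst sum.atMost_Suc_shift) (simp add: M)
    also have "\<dots> = (\<Sum>s\<le>L + 2. t s / 4 ^ Suc s)" by (intro sum.cong refl) (simp add: t del: mult_Suc_right)
    also have "\<dots> = (u (L + 2) + 2 * u (L + 1) + u L) / 4"
    proof -
      have 1: "(\<Sum>s\<le>L + 2. (if s \<le> L + 1 then real ((2 * s) choose (L + 1 - s)) else 0) / 4 ^ s) = u (L + 1)"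
        unfolding u_def by (intro sum.mono_neutral_cong_right) auto
      have 2: "(\<Sum>s\<le>L + 2. (if s \<le> L then real ((2 * s) choose (L - s)) else 0) / 4 ^ s) = u L"
        unfolding u_def by (intro sum.mono_neutral_cong_right) auto
      show ?thesis unfolding 1[symmetric] 2[symmetric] unfolding u_def t_def
        by (simp only: sum_distrib_left sum_divide_distrib sum.distrib[symmetric]) (intro sum.cong refl, simp add: field_simps)
    qed
    also have "\<dots> \<le> 1" using less[of "L + 2"] less[of "L + 1"] less[of L] by (simp add: M u_def)
    finally show ?thesis by (simp add: u_def)
  qed
qed

subsection \<open>The position of a card after the shuffle\<close>

lemma finite_set_pmf_shelf_shuffle: "finite (set_pmf (shelf_shuffle xs))"
  by (induction xs) auto

lemma set_pmf_shelf_shuffle: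
  "pile \<in> set_pmf (shelf_shuffle xs) \<Longrightarrow> length pile = length xs \<and> set pile = set xs"
  by (induction xs arbitrary: pile) (auto split: if_splits)

text \<open>Conditions on the coin of the last card drawn, which is the top card of the
  deck.\<close>

lemma expectation_shelf_shuffle_Cons:
  fixes f :: "'a list \<Rightarrow> real"
  shows "measure_pmf.expectation (shelf_shuffle (c # cs)) f =
    (measure_pmf.expectation (shelf_shuffle cs) (\<lambda>p. f (c # p)) + measure_pmf.expectation (shelf_shuffle cs) (\<lambda>p. f (p @ [c]))) / 2"
proof -
  have "measure_pmf.expectation (shelf_shuffle (c # cs)) f = measure_pmf.expectation (shelf_shuffle cs)
      (\<lambda>p. (f (c # p) + f (p @ [c])) / 2)"
    unfolding shelf_shuffle.simps
    by (subst pmf_expectation_bind[OF finite_set_pmf_shelf_shuffle])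
       (auto simp: integral_measure_pmf[OF finite_set_pmf_shelf_shuffle] add_divide_distrib)
  thus ?thesis
    by (simp add: integrable_measure_pmf_finite finite_set_pmf_shelf_shuffle)
qed

text \<open>The card at index \<open>i\<close> is followed by \<open>i\<close> further draws. If it
  was put on top, it ends at index \<open>j\<close> when exactly \<open>j\<close> of these go on
  top; if it was put at the bottom, when exactly \<open>length xs - 1 - j\<close> go below it. The
  induction conditions on the last draw, and Pascal's rule combines the two outcomes.\<close>

lemma expectation_shelf_shuffle_position:
  assumes "distinct xs" "i < length xs" "j < length xs"
  shows "measure_pmf.expectation (shelf_shuffle xs) (\<lambda>pile. of_bool (pile ! j = xs ! i)) =
    (real (i choose j) + real (i choose (length xs - 1 - j))) / 2 ^ Suc i"
  using assms
proof (induction xs arbitrary: i j)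
  case (Cons c cs)
  let ?E = "measure_pmf.expectation (shelf_shuffle cs) :: (_ \<Rightarrow> real) \<Rightarrow> real"
  have E_cong: "?E f = ?E g" if "\<And>p. length p = length cs \<Longrightarrow> set p = set cs \<Longrightarrow> f p = g p" for f g :: "_ \<Rightarrow> real"
    by (rule integral_cong_AE) (auto intro!: AE_pmfI that dest: set_pmf_shelf_shuffle)
  show ?case
  proof (cases i)
    case 0
    have "?E (\<lambda>p. of_bool ((c # p) ! j = c)) = ?E (\<lambda>p. of_bool (j = 0))"
    proof (intro E_cong)
      fix p assume "length p = length cs" "set p = set cs"
      then show "of_bool ((c # p) ! j = c) = (of_bool (j = 0) :: real)"
        using Cons.prems nth_mem[of "j - 1" p] by (cases j) auto
    qed
    moreover have "?E (\<lambda>p. of_bool ((p @ [c]) ! j = c)) = ?E (\<lambda>p. of_bool (j = length cs))"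
    proof (intro E_cong)
      fix p assume "length p = length cs" "set p = set cs"
      then show "of_bool ((p @ [c]) ! j = c) = (of_bool (j = length cs) :: real)"
        using Cons.prems nth_mem[of j p] by (auto simp: nth_append)
    qed
    ultimately show ?thesis using Cons.prems 0
      by (auto simp: expectation_shelf_shuffle_Cons binomial_eq_0 simp del: shelf_shuffle.simps)
  next
    case (Suc k)
    have k: "k < length cs" using Cons.prems Suc by simp
    have ne: "cs ! k \<noteq> c" using Cons.prems k by auto
    have "?E (\<lambda>p. of_bool ((c # p) ! j = cs ! k)) = (if j = 0 then 0 else ?E (\<lambda>p. of_bool (p ! (j - 1) = cs ! k)))"
      using ne by (auto simp: nth_Cons')
    also have "\<dots> = (if j = 0 then 0 else (real (k choose (j - 1)) + real (k choose (length cs - j))) / 2 ^ Suc k)"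
      using Cons k by auto
    finally have 1: "?E (\<lambda>p. of_bool ((c # p) ! j = cs ! k)) = \<dots>" .
    have "?E (\<lambda>p. of_bool ((p @ [c]) ! j = cs ! k)) = ?E (\<lambda>p. if j = length cs then 0 else of_bool (p ! j = cs ! k))"
      using Cons.prems ne by (intro E_cong) (auto simp: nth_append)
    also have "\<dots> = (if j = length cs then 0 else ?E (\<lambda>p. of_bool (p ! j = cs ! k)))" by simp
    also have "\<dots> = (if j = length cs then 0 else (real (k choose j) + real (k choose (length cs - 1 - j))) / 2 ^ Suc k)"
      using Cons k by auto
    finally have 2: "?E (\<lambda>p. of_bool ((p @ [c]) ! j = cs ! k)) = \<dots>" .
    \<comment> \<open>The cases \<open>j = 0\<close> and \<open>j = length cs\<close> are the ends
      of the pile, taken by \<open>c\<close> itself; there the truncated lower index would be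
      wrong.\<close>
    have 3: "Suc k choose j = (if j = 0 then 0 else k choose (j - 1)) + (k choose j)" by (cases j) auto
    have 4: "Suc k choose (length cs - j) = (k choose (length cs - j)) + (if j = length cs then 0 else k choose (length cs - 1 - j))"
      using Cons.prems by (cases "length cs - j") (auto, metis diff_Suc_1 diff_commute plus_1_eq_Suc diff_diff_left add.commute)
    show ?thesis using k Cons.prems
      by (auto simp: expectation_shelf_shuffle_Cons Suc 1 2 3 4 field_simps simp del: shelf_shuffle.simps)
  qed
qed simp

text \<open>This is $p_{i,j}$ for $1 \le i, j \le n$.\<close>
definition hit_prob :: "nat \<Rightarrow> nat \<Rightarrow> nat \<Rightarrow> real" where
  "hit_prob n i j = (real ((i - 1) choose (j - 1)) + real ((i - 1) choose (n - j))) / 2 ^ i"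

lemma expected_correct_eq_sum_hit_prob:
  assumes "\<And>j. j \<in> {1..n} \<Longrightarrow> g j \<in> {1..n}"
  shows "expected_correct n g = (\<Sum>j\<in>{1..n}. hit_prob n (g j) j)"
proof -
  let ?M = "shelf_shuffle [1..<Suc n]"
  have "expected_correct n g = measure_pmf.expectation ?M (\<lambda>pile. \<Sum>j\<in>{1..n}. of_bool (pile ! (j - 1) = g j))"
    unfolding expected_correct_def correct_guesses_def by (simp add: sum_of_bool_eq Int_def conj_ac)
  also have "\<dots> = (\<Sum>j\<in>{1..n}. measure_pmf.expectation ?M (\<lambda>pile. of_bool (pile ! (j - 1) = g j)))"
    by (intro Bochner_Integration.integral_sum integrable_measure_pmf_finite finite_set_pmf_shelf_shuffle)
  also have "\<dots> = (\<Sum>j\<in>{1..n}. hit_prob n (g j) j)"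
  proof (rule sum.cong[OF refl])
    fix j assume j: "j \<in> {1..n}"
    have g: "1 \<le> g j" "g j \<le> n" using assms[OF j] by auto
    have "[1..<Suc n] ! (g j - 1) = g j" using g by (subst nth_upt) auto
    moreover have "n - 1 - (j - 1) = n - j" "Suc (g j - 1) = g j" using j g by auto
    moreover have "length [1..<Suc n] = n" "g j - 1 < n" "j - 1 < n" using j g by auto
    ultimately show "measure_pmf.expectation ?M (\<lambda>pile. of_bool (pile ! (j - 1) = g j)) = hit_prob n (g j) j"
      unfolding hit_prob_def using expectation_shelf_shuffle_position[of "[1..<Suc n]" "g j - 1" "j - 1"]
      by (metis distinct_upt)
  qed
  finally show ?thesis .
qed

section \<open>Symmetry and upper bounds for the hit probabilities\<close>

lemma hit_prob_reflect:
  assumes "j \<in> {1..n}"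
  shows "hit_prob n i (n + 1 - j) = hit_prob n i j"
proof -
  have "n + 1 - j - 1 = n - j" "n - (n + 1 - j) = j - 1" using assms by auto
  thus ?thesis by (simp add: hit_prob_def)
qed

lemma hit_prob_le_central:
  assumes "i \<ge> 1"
  shows "hit_prob n i j \<le> central_prob ((i - 1) div 2)"
proof -
  obtain k where i: "i = Suc k" using assms by (cases i) auto
  have "hit_prob n i j = (real (k choose (j - 1)) / 2 ^ k + real (k choose (n - j)) / 2 ^ k) / 2"
    by (simp add: hit_prob_def i field_simps)
  thus ?thesis
    using binomial_prob_le_central[of k "j - 1"] binomial_prob_le_central[of k "n - j"] by (simp add: i)
qed

text \<open>With r = j - 1, both guesses have the same near-end term, because (2r choose r) = 2
  (2r-1 choose r). The far-end term is half the renewal term for the odd guess and at most the whole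
  one for the even guess.\<close>

lemma hit_prob_le_diagonal:
  assumes "j \<ge> 1" "i = 2 * j - 1 \<or> i = 2 * j - 2 \<and> j \<ge> 2"
  shows "hit_prob n i j \<le> central_prob (j - 1) / 2 + real ((2 * (j - 1)) choose (n - j)) / 4 ^ (j - 1)"
proof -
  obtain r where j: "j = Suc r" using assms(1) by (cases j) auto
  show ?thesis
  proof (cases "i = Suc (2 * r)")
    case True
    hence "(2::real) ^ i = 2 * 4 ^ r" by (simp add: power_mult)
    hence "hit_prob n i j = central_prob r / 2 + (real ((2 * r) choose (n - j)) / 4 ^ r) / 2"
      using True by (simp add: hit_prob_def central_prob_def j add_divide_distrib)
    moreover have "(real ((2 * r) choose (n - j)) / 4 ^ r) / 2 \<le> real ((2 * r) choose (n - j)) / 4 ^ r"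
      by (simp add: divide_left_mono)
    ultimately show ?thesis by (simp add: j)
  next
    case False
    then obtain q where r: "r = Suc q" and i: "i = Suc (Suc (2 * q))" using assms by (cases r) (auto simp: j)
    have "(2 * r) choose r = 2 * (Suc (2 * q) choose r)"
      using central_binomial_odd[of "Suc (2 * q)"] by (simp add: r)
    moreover have "Suc (2 * q) choose (n - j) \<le> (2 * r) choose (n - j)"
      by (rule binomial_right_mono) (simp add: r)
    moreover have "(2::real) ^ i = 4 ^ r" by (simp add: i r power_mult)
    ultimately show ?thesis
      by (simp add: hit_prob_def central_prob_def i j add_divide_distrib divide_right_mono)
  qed
qed

subsection \<open>The expected number of correct guesses\<close>

lemma strat_m_le:
  assumes "n > 0"
  shows "2 * real (strat_m n) \<le> sqrt (real n)"
proof -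
  \<comment> \<open>Bounds the admissible values of \<open>m\<close> by \<open>n\<close>, so that
    \<open>GREATEST\<close> is attained.\<close>
  have *: "x \<le> n" if "x \<le> y" "y\<^sup>2 + 1 \<le> n" for x y :: nat
    using that le_square[of y] unfolding power2_eq_square by linarith
  have "(2 * strat_m n)\<^sup>2 \<le> n"
  proof (cases "odd n")
    case True
    let ?P = "\<lambda>m. (2 * m)\<^sup>2 + 1 \<le> n"
    have "?P 0" using assms by simp
    moreover have "m \<le> n" if "?P m" for m
      using that by (rule *[rotated]) simp
    ultimately have "?P (Greatest ?P)" by (rule GreatestI_nat)
    then show ?thesis using True by (simp add: strat_m_def)
  next
    case False
    let ?P = "\<lambda>m. (2 * m + 1)\<^sup>2 + 1 \<le> n"
    have "n \<ge> 2" using assms False by (cases "n = 1") auto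
    hence "?P 0" by simp
    moreover have "m \<le> n" if "?P m" for m
      using that by (rule *[rotated]) simp
    ultimately have "?P (Greatest ?P)" by (rule GreatestI_nat)
    moreover have "(2 * Greatest ?P)\<^sup>2 \<le> (2 * Greatest ?P + 1)\<^sup>2" by (intro power_mono) auto
    ultimately have "(2 * Greatest ?P)\<^sup>2 \<le> n" by linarith
    then show ?thesis using False by (simp only: strat_m_def if_False)
  qed
  hence "(2 * real (strat_m n))\<^sup>2 \<le> real n"
    by (metis of_nat_le_iff of_nat_mult of_nat_numeral of_nat_power)
  thus ?thesis by (rule real_le_rsqrt)
qed

lemma half_guess_set_subset:
  assumes "n \<ge> 6" "1 \<le> j" "j \<le> strat_half n"
  shows "half_guess_set n j \<subseteq> {1..n}"
proof -
  have "2 * j \<le> n + 1" using assms(3) unfolding strat_half_def by presburger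
  thus ?thesis using assms(1,2) by (auto simp: half_guess_set_def)
qed

text \<open>Bounds the probability of finding one of the last four cards in a given position.\<close>
definition tail_bound :: "nat \<Rightarrow> real" where
  "tail_bound n = 1 / sqrt (pi * (real n - 5) / 2)"

text \<open>Adding the diagonal and the tail estimate, instead of taking their maximum, lets each
  part be summed over \<open>j\<close> separately.\<close>

definition hit_bound :: "nat \<Rightarrow> nat \<Rightarrow> real" where
  "hit_bound n j = central_prob (j - 1) / 2 + real ((2 * (j - 1)) choose (n - j)) / 4 ^ (j - 1)
     + of_bool (strat_half n - strat_m n \<le> j) * tail_bound n"

lemma hit_bound_nonneg: "n \<ge> 6 \<Longrightarrow> hit_bound n j \<ge> 0"
  by (auto simp: hit_bound_def tail_bound_def central_prob_def intro!: add_nonneg_nonneg divide_nonneg_nonneg)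

lemma hit_prob_le_hit_bound:
  assumes "n \<ge> 6" "1 \<le> j" "i \<in> half_guess_set n j"
  shows "hit_prob n i j \<le> hit_bound n j"
proof (cases "i = 2 * j - 1 \<or> i = 2 * j - 2 \<and> j \<ge> 2")
  case True
  have "0 \<le> of_bool (strat_half n - strat_m n \<le> j) * tail_bound n"
    using assms(1) by (simp add: tail_bound_def)
  then show ?thesis unfolding hit_bound_def using hit_prob_le_diagonal[OF assms(2) True, of n] by linarith
next
  case False
  have "strat_half n - strat_m n \<le> j \<and> i \<in> {n - 3, n - 2, n - 1, n}"
    using assms False by (auto simp: half_guess_set_def split: if_splits)
  hence j: "strat_half n - strat_m n \<le> j" and i: "i \<ge> n - 3" by auto
  define q where "q = (i - 1) div 2"
  \<comment> \<open>From i \<ge> n - 3 follows 2q \<ge> i - 2 \<ge> n - 5, the source of the 5 in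
    \<open>tail_bound\<close>.\<close>
  have q: "q > 0" "2 * q + 5 \<ge> n" using i assms(1) unfolding q_def by linarith+
  have "hit_prob n i j \<le> central_prob q"
    unfolding q_def using i assms(1) by (intro hit_prob_le_central) linarith
  also have "\<dots> \<le> 1 / sqrt (pi * real q)" using q by (intro central_prob_le)
  also have "\<dots> \<le> tail_bound n" unfolding tail_bound_def
    using q assms(1) by (intro divide_left_mono mult_pos_pos real_sqrt_le_mono) auto
  also have "\<dots> \<le> hit_bound n j"
    using j central_prob_pos[of "j - 1"] by (simp add: hit_bound_def)
  finally show ?thesis .
qed

lemma sum_hit_bound_le:
  assumes "n \<ge> 6"
  shows "(\<Sum>j\<in>{1..strat_half n}. hit_bound n j)
    \<le> sqrt (real (strat_half n) / pi) + 1 + (sqrt (real n) / 2 + 1) * tail_bound n"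
proof -
  let ?h = "strat_half n" and ?m = "strat_m n"
  have "(\<Sum>j\<in>{1..?h}. central_prob (j - 1) / 2) = (\<Sum>k<?h. central_prob k) / 2"
    by (simp add: sum.atLeast1_atMost_eq sum_divide_distrib)
  also have "\<dots> \<le> sqrt (real ?h / pi)" using sum_central_prob_le[of ?h] by simp
  finally have 1: "(\<Sum>j\<in>{1..?h}. central_prob (j - 1) / 2) \<le> sqrt (real ?h / pi)" .
  \<comment> \<open>With r = j - 1 these are the first terms of the renewal sum for M = n -
    1.\<close>
  have "(\<Sum>j\<in>{1..?h}. real ((2 * (j - 1)) choose (n - j)) / 4 ^ (j - 1))
      = (\<Sum>r<?h. real ((2 * r) choose (n - 1 - r)) / 4 ^ r)"
    by (simp add: sum.atLeast1_atMost_eq)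
  also have "\<dots> \<le> (\<Sum>r\<le>n - 1. real ((2 * r) choose (n - 1 - r)) / 4 ^ r)"
    using assms by (intro sum_mono2) (auto simp: strat_half_def elim!: oddE split: if_splits)
  also have "\<dots> \<le> 1" by (rule sum_renewal_le_1)
  finally have 2: "(\<Sum>j\<in>{1..?h}. real ((2 * (j - 1)) choose (n - j)) / 4 ^ (j - 1)) \<le> 1" .
  have "(\<Sum>j\<in>{1..?h}. of_bool (?h - ?m \<le> j)) = real (card ({1..?h} \<inter> {j. ?h - ?m \<le> j}))"
    by (simp add: sum_of_bool_eq)
  also have "card ({1..?h} \<inter> {j. ?h - ?m \<le> j}) \<le> card {?h - ?m..?h}" by (intro card_mono) auto
  hence "real (card ({1..?h} \<inter> {j. ?h - ?m \<le> j})) \<le> real ?m + 1" by simp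
  also have "\<dots> \<le> sqrt (real n) / 2 + 1" using strat_m_le[of n] assms by simp
  finally have "(\<Sum>j\<in>{1..?h}. of_bool (?h - ?m \<le> j)) * tail_bound n \<le> (sqrt (real n) / 2 + 1) * tail_bound n"
    using assms by (intro mult_right_mono) (auto simp: tail_bound_def)
  with 1 2 show ?thesis
    unfolding hit_bound_def sum.distrib sum_distrib_right[symmetric] by linarith
qed

lemma expected_correct_le:
  assumes "n \<ge> 6" "follows_strategy n g"
  shows "expected_correct n g
    \<le> 2 * (sqrt ((real n + 1) / (2 * pi)) + 1 + (sqrt (real n) / 2 + 1) * tail_bound n)"
proof -
  let ?h = "strat_half n"
  have h: "n \<le> 2 * ?h" "2 * ?h \<le> n + 1" by (auto simp: strat_half_def)
  have guess: "g j \<in> guess_set n j" if "j \<in> {1..n}" for j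
    using assms(2) that by (simp add: follows_strategy_def)
  have low: "g j \<in> half_guess_set n j" if "j \<in> {1..?h}" for j
    using guess[of j] that h assms(1) by (simp add: guess_set_def)
  have high: "g j \<in> half_guess_set n (n + 1 - j)" if "j \<in> {?h<..n}" for j
    using guess[of j] that by (simp add: guess_set_def)
  have "expected_correct n g = (\<Sum>j\<in>{1..n}. hit_prob n (g j) j)"
  proof (rule expected_correct_eq_sum_hit_prob)
    fix j assume j: "j \<in> {1..n}"
    show "g j \<in> {1..n}"
      using low[of j] high[of j] j h half_guess_set_subset[OF assms(1), of j] half_guess_set_subset[OF assms(1), of "n + 1 - j"]
      by (cases "j \<le> ?h") (auto simp: subset_iff)
  qed
  also have "{1..n} = {1..?h} \<union> {?h<..n}" using h assms(1) by auto
  also have "(\<Sum>j\<in>\<dots>. hit_prob n (g j) j) = (\<Sum>j\<in>{1..?h}. hit_prob n (g j) j) + (\<Sum>j\<in>{?h<..n}. hit_prob n (g j) j)"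
    by (rule sum.union_disjoint) auto
  also have "(\<Sum>j\<in>{1..?h}. hit_prob n (g j) j) \<le> (\<Sum>j\<in>{1..?h}. hit_bound n j)"
    using low assms(1) by (intro sum_mono hit_prob_le_hit_bound) auto
  also have "(\<Sum>j\<in>{?h<..n}. hit_prob n (g j) j) = (\<Sum>j\<in>{?h<..n}. hit_prob n (g j) (n + 1 - j))"
    by (intro sum.cong refl hit_prob_reflect[symmetric]) auto
  also have "\<dots> \<le> (\<Sum>j\<in>{?h<..n}. hit_bound n (n + 1 - j))"
    using high assms(1) by (intro sum_mono hit_prob_le_hit_bound) auto
  also have "\<dots> = (\<Sum>j\<in>{1..n - ?h}. hit_bound n j)"
    by (rule sum.reindex_bij_witness[where i = "\<lambda>j. n + 1 - j" and j = "\<lambda>j. n + 1 - j"]) auto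
  \<comment> \<open>For odd \<open>n\<close> the reflected half has one position fewer; counting the
    middle position twice only enlarges the bound.\<close>
  also have "\<dots> \<le> (\<Sum>j\<in>{1..?h}. hit_bound n j)"
    using h by (intro sum_mono2 hit_bound_nonneg assms) auto
  finally have "expected_correct n g \<le> 2 * (\<Sum>j\<in>{1..?h}. hit_bound n j)" by simp
  also have "\<dots> \<le> 2 * (sqrt (real ?h / pi) + 1 + (sqrt (real n) / 2 + 1) * tail_bound n)"
    using sum_hit_bound_le[OF assms(1)] by simp
  also have "sqrt (real ?h / pi) \<le> sqrt ((real n + 1) / (2 * pi))"
    using h by (intro real_sqrt_le_mono) (simp add: field_simps)
  finally show ?thesis by simp
qed

theorem theorem1p3:
  fixes g :: "nat \<Rightarrow> nat \<Rightarrow> nat"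
  assumes "\<And>n. n \<ge> 6 \<Longrightarrow> follows_strategy n (g n)"
  shows "\<exists>C :: nat \<Rightarrow> real.
    limsup (\<lambda>n. ereal (C n /
      (exp (-2) * (2 * pi) powr (-1/2) * (real n - sqrt (real n)) powr (1/2)))) \<le> 1 \<and>
    (\<lambda>n. expected_correct n (g n)) \<sim>[sequentially]
      (\<lambda>n. sqrt (2 / pi) * sqrt (real n - sqrt (real n)) + 2 * std_normal_cdf 1 - 1 + C n)"
proof -
  define main where "main n = sqrt (2 / pi) * sqrt (real n - sqrt (real n)) + 2 * std_normal_cdf 1 - 1" for n
  define D where "D n = exp (-2) * (2 * pi) powr (-1/2) * (real n - sqrt (real n)) powr (1/2)" for n
  define U where "U n = 2 * (sqrt ((real n + 1) / (2 * pi)) + 1 + (sqrt (real n) / 2 + 1) * tail_bound n)" for n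
  \<comment> \<open>With this choice both sides of the asymptotic relation are equal, so only the
    limsup remains.\<close>
  define C where "C n = expected_correct n (g n) - main n" for n
  have le: "C n / D n \<le> (U n - main n) / D n" if "n \<ge> 6" for n
    using expected_correct_le[OF that assms[OF that]] by (intro divide_right_mono) (auto simp: C_def U_def D_def)
  have "(\<lambda>n. (U n - main n) / D n) \<longlonglongrightarrow> 0"
  proof -
    \<comment> \<open>Here \<open>c\<close> is sqrt(2/pi), \<open>d\<close> is 2 Phi(1) - 1,
      \<open>p\<close> is pi and \<open>K\<close> is the constant factor of \<open>D\<close>. The
      two square roots share the coefficient \<open>c\<close>, so their difference stays bounded, as
      do the other terms of the numerator, while the denominator grows like sqrt n.\<close>
    have lim: "(\<lambda>n. (c * sqrt (real n + 1) + 2 * (1 + (sqrt (real n) / 2 + 1) * (1 / sqrt (p * (real n - 5) / 2)))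
        - (c * sqrt (real n - sqrt (real n)) + d)) / (K * (real n - sqrt (real n)) powr (1/2))) \<longlonglongrightarrow> 0"
      if "p > 0" "K > 0" for c d p K :: real
      using that by real_asymp
    have "2 * sqrt ((real n + 1) / (2 * pi)) = sqrt (2 / pi) * sqrt (real n + 1)" for n
    proof -
      have "2 * sqrt ((real n + 1) / (2 * pi)) = sqrt (2\<^sup>2 * ((real n + 1) / (2 * pi)))"
        unfolding real_sqrt_mult by simp
      also have "2\<^sup>2 * ((real n + 1) / (2 * pi)) = 2 / pi * (real n + 1)"
        by (simp add: power2_eq_square divide_simps)
      finally show ?thesis by (simp only: real_sqrt_mult)
    qed
    hence "(U n - main n) / D n = (sqrt (2 / pi) * sqrt (real n + 1)
        + 2 * (1 + (sqrt (real n) / 2 + 1) * (1 / sqrt (pi * (real n - 5) / 2)))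
        - (sqrt (2 / pi) * sqrt (real n - sqrt (real n)) + (2 * std_normal_cdf 1 - 1)))
        / ((exp (-2) * (2 * pi) powr (-1/2)) * (real n - sqrt (real n)) powr (1/2))" for n
      unfolding U_def main_def D_def tail_bound_def by (simp add: algebra_simps)
    thus ?thesis by (simp only:) (rule lim; simp)
  qed
  hence "limsup (\<lambda>n. ereal ((U n - main n) / D n)) = ereal 0"
    by (intro lim_imp_Limsup tendsto_ereal) auto
  moreover have "limsup (\<lambda>n. ereal (C n / D n)) \<le> limsup (\<lambda>n. ereal ((U n - main n) / D n))"
    using le by (intro Limsup_mono eventually_sequentiallyI[of 6]) simp
  \<comment> \<open>The limsup is even at most 0.\<close>
  ultimately have "limsup (\<lambda>n. ereal (C n / D n)) \<le> 1"
    by (metis ereal_less_eq(3) order_trans zero_le_one one_ereal_def)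
  moreover have "(\<lambda>n. expected_correct n (g n)) = (\<lambda>n. main n + C n)" by (simp add: C_def)
  ultimately show ?thesis unfolding main_def D_def by (intro exI[of _ C]) simp
qed

end
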